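(* Let $(\Omega,\mathcal{A},\mathbb{P})$ be a probability space, $n_0\in\mathbb{N}_0$, and let $(A_n)_{n\geq n_0}$ be a sequence of events such that $\sum_{n=n_0}^\infty \mathbb{P}(A_n)<\infty$. Then for any positive, nondecreasing sequence $(a_n)_{n\geq n_0}$ the following statements are true, with $\mathcal{O}_{n_0}$, $\mathbf{m}_{n_0}$ and $\mathcal{S}_{a,n_0}$ as defined in the context. (a) If the sequence $(A_n)_{n\geq n_0}$ is nested, that is, $A_{n+1}\subseteq A_n$ for $n\geq n_0$, then $$\mathbb{E}[\mathcal{S}_{a,n_0}(\mathcal{O}_{n_0})]=\sum_{n=n_0}^\infty a_n\,\mathbb{P}(A_n).$$ (b) For a sequence $(A_n)_{n\geq n_0}$ which is not necessarily nested, the following relations are valid: (i) For all $\omega\in\Omega$ we have $$\mathbf{m}_{n_0}(\omega)=\sum_{n=n_0}^\infty \mathbf{1}\Big(\bigcup_{m=n}^\infty A_m\Big)(\omega).$$ (ii) We have the moment estimate $$\mathbb{E}[\mathcal{S}_{a,n_0}(\mathcal{O}_{n_0})]\leq \mathbb{E}[\mathcal{S}_{a,n_0}(\mathbf{m}_{n_0})]=\sum_{n=n_0}^\infty a_n\,\mathbb{P}\Big(\bigcup_{m=n}^\infty A_m\Big)\leq \sum_{n=n_0}^\infty a_n\sum_{m=n}^\infty \mathbb{P}(A_m)=K_a,$$ where $K_a$ is the name for the last double sum.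
   Context: $\mathbb{N}=\{1,2,\dots\}$, $\mathbb{N}_0=\{0,1,2,\dots\}$. $\mathbf{1}(A)$ is the indicator function of the event $A$. Overlap count: $\mathcal{O}_{n_0}(\omega):=\sum_{n=n_0}^\infty \mathbf{1}(A_n)(\omega)$, $\omega\in\Omega$. Last occurrence index: $\mathbf{m}_{n_0}(\omega):=\max\{i\geq n_0 : \omega\in A_i\}$. For a nonnegative, nondecreasing sequence $a=(a_n)$: $\mathcal{S}_{a,n_0}(N):=\sum_{n=0}^{N-1}a_{n_0+n}$ for $N\in\mathbb{N}$, and $\mathcal{S}_{a,n_0}(0):=0$.
   Formalization: The last occurrence index is taken as max{i≥n_0 : ω∈A_i} − n_0 + 1 (0 if no event occurs, ∞ if infinitely many do); with the literal maximum, (b) fails for n_0≠1, e.g. A_{n_0}=Ω and all other A_n empty. *)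

theory Defs
  imports "HOL-Probability.Probability"
begin

text \<open>Overlap counts and last occurrence indices are infinite on the event that infinitely many
  \<open>A n\<close> occur, so they take values in \<^typ>\<open>enat\<close>.\<close>

definition overlap_count :: "(nat \<Rightarrow> 'a set) \<Rightarrow> nat \<Rightarrow> 'a \<Rightarrow> enat" where
  "overlap_count A n0 \<omega> = (\<Sum>k. indicator (A (n0 + k)) \<omega>)"

text \<open>The maximum of \<open>{i. i \<ge> n0 \<and> \<omega> \<in> A i}\<close>, with the convention that it is \<open>0\<close> for the
  empty set and \<open>\<infinity>\<close> for an infinite set.\<close>

definition max_index :: "(nat \<Rightarrow> 'a set) \<Rightarrow> nat \<Rightarrow> 'a \<Rightarrow> enat" where
  "max_index A n0 \<omega> =
     (let I = {i. n0 \<le> i \<and> \<omega> \<in> A i}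
      in if I = {} then 0 else if finite I then enat (Max I) else \<infinity>)"

text \<open>The last occurrence index is the position of the last occurring event within the sequence
  \<open>A n0, A (n0 + 1), \<dots>\<close>, where \<open>A n0\<close> has position 1. It is thus the maximum above when
  \<open>n0 = 1\<close>. For other \<open>n0\<close> the unshifted maximum is not the number of \<open>n \<ge> n0\<close> with
  \<open>\<omega> \<in> (\<Union>m\<in>{n..}. A m)\<close>, as the second lemma below shows.\<close>

definition last_occurrence :: "(nat \<Rightarrow> 'a set) \<Rightarrow> nat \<Rightarrow> 'a \<Rightarrow> enat" where
  "last_occurrence A n0 \<omega> =
     (if \<exists>i\<ge>n0. \<omega> \<in> A i then max_index A n0 \<omega> + 1 - enat n0 else 0)"

lemma last_occurrence_1: "last_occurrence A 1 \<omega> = max_index A 1 \<omega>"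
  by (auto simp: last_occurrence_def max_index_def Let_def one_enat_def)

lemma max_index_unshifted:
  fixes \<omega> :: 'a and n0 :: nat
  defines "A \<equiv> (\<lambda>n. if n = n0 then UNIV else {} :: 'a set)"
  shows "max_index A n0 \<omega> = enat n0"
    and "(\<Sum>k. indicator (\<Union>m\<in>{n0 + k..}. A m) \<omega> :: enat) = 1"
proof -
  have I: "{i. n0 \<le> i \<and> \<omega> \<in> A i} = {n0}"
    by (auto simp: A_def split: if_splits)
  show "max_index A n0 \<omega> = enat n0"
    unfolding max_index_def Let_def I by simp
  have "(indicator (\<Union>m\<in>{n0 + k..}. A m) \<omega> :: enat) = (if k = 0 then 1 else 0)" for k
    by (auto simp: A_def indicator_def)
  then have "(\<Sum>k. indicator (\<Union>m\<in>{n0 + k..}. A m) \<omega> :: enat) = (\<Sum>k. if k = 0 then 1 else 0)"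
    by (simp only:)
  also have "\<dots> = (\<Sum>k\<in>{0::nat}. if k = 0 then 1 else 0)"
    by (rule suminf_finite) auto
  finally show "(\<Sum>k. indicator (\<Union>m\<in>{n0 + k..}. A m) \<omega> :: enat) = 1"
    by simp
qed

text \<open>Partial sums of \<open>a\<close> from index \<open>n0\<close>, extended to \<open>N = \<infinity>\<close> by the full series.\<close>

definition shifted_sum :: "(nat \<Rightarrow> real) \<Rightarrow> nat \<Rightarrow> enat \<Rightarrow> ennreal" where
  "shifted_sum a n0 N =
     (case N of enat k \<Rightarrow> ennreal (\<Sum>n<k. a (n0 + n)) | \<infinity> \<Rightarrow> (\<Sum>n. ennreal (a (n0 + n))))"

end

theory Submission
  imports Defs
begin

text \<open>Everything is read off from the level sets \<open>n < N\<close> of a counting variable \<open>N\<close>: the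
  shifted sum at \<open>N\<close> is the series of the \<open>a (n0 + n)\<close> with \<open>n < N\<close>, and for nested events the
  number of occurring events exceeds \<open>n\<close> exactly when the event with index \<open>n\<close> (counted from 0)
  occurs. Integrating termwise gives (a). The last occurrence index is the overlap count of the
  nested events \<open>\<Union>m\<ge>n. A m\<close>, which contain the \<open>A n\<close>, so (b) follows from (a) by monotonicity
  and countable subadditivity.\<close>

text \<open>If the two differed, the smaller one would be finite, and taking it as \<open>n\<close>
  would separate them: it lies below the larger one but not below itself.\<close>

lemma enat_eqI_less:
  fixes x y :: enat
  assumes "\<And>n. enat n < x \<longleftrightarrow> enat n < y"
  shows "x = y"
proof (cases x y rule: linorder_cases)
  case less
  then show ?thesis
    using assms by (cases x) auto
next
  case greater
  then show ?thesis
    using assms by (cases y) auto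
qed

text \<open>Since \<open>B\<close> decreases, the indices \<open>k\<close> with
  \<open>\<omega> \<in> B k\<close> form an initial segment of the naturals, and the series is its
  length, possibly infinite.\<close>

lemma less_suminf_indicator_decseq_iff:
  assumes "decseq B"
  shows "enat n < (\<Sum>k. indicator (B k) \<omega>) \<longleftrightarrow> \<omega> \<in> B n"
proof
  assume "\<omega> \<in> B n"
  then have "\<omega> \<in> B k" if "k \<le> n" for k
    using decseqD[OF assms that] by blast
  \<comment> \<open>Counting starts at index 0, so the indices up to \<open>n\<close> contribute
    \<open>Suc n\<close> ones; this makes the inequality strict.\<close>
  then have "(\<Sum>k<Suc n. indicator (B k) \<omega> :: enat) = (\<Sum>k<Suc n. 1)"
    by (intro sum.cong) auto
  also have "\<dots> = enat (Suc n)"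
    by (simp only: sum_constant card_lessThan mult_1_right of_nat_eq_enat)
  finally have "enat (Suc n) \<le> (\<Sum>k. indicator (B k) \<omega>)"
    using sum_le_suminf[of "\<lambda>k. indicator (B k) \<omega> :: enat" "{..<Suc n}"] by (simp add: summableI)
  then show "enat n < (\<Sum>k. indicator (B k) \<omega>)"
    by (rule less_le_trans[rotated]) simp
next
  assume less: "enat n < (\<Sum>k. indicator (B k) \<omega>)"
  show "\<omega> \<in> B n"
  proof (rule ccontr)
    assume "\<omega> \<notin> B n"
    \<comment> \<open>Missing \<open>B n\<close> means missing every later set, so only the
      \<open>n\<close> indices below \<open>n\<close> can contribute.\<close>
    then have "\<omega> \<notin> B k" if "n \<le> k" for k
      using decseqD[OF assms that] by blast
    then have "(\<Sum>k. indicator (B k) \<omega> :: enat) = (\<Sum>k<n. indicator (B k) \<omega>)"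
      by (intro suminf_finite) auto
    also have "\<dots> \<le> (\<Sum>k<n. 1)"
      by (intro sum_mono) (simp add: indicator_def)
    also have "\<dots> = enat n"
      by (simp add: of_nat_eq_enat)
    finally show False
      using less by simp
  qed
qed

text \<open>This form treats finite and infinite \<open>N\<close> alike and confines
  \<open>N\<close> to the condition of each term. Nonnegativity lets \<open>ennreal\<close> pass
  through the finite sum.\<close>

lemma shifted_sum_eq_suminf:
  assumes "\<And>n. n0 \<le> n \<Longrightarrow> 0 \<le> a n"
  shows "shifted_sum a n0 N = (\<Sum>n. if enat n < N then ennreal (a (n0 + n)) else 0)"
proof (cases N)
  case (enat k)
  have "(\<Sum>n. if enat n < N then ennreal (a (n0 + n)) else 0) = (\<Sum>n<k. ennreal (a (n0 + n)))"
    using enat by (subst suminf_finite[of "{..<k}"]) auto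
  then show ?thesis
    using enat assms by (simp add: shifted_sum_def sum_ennreal)
qed (simp add: shifted_sum_def)

lemma shifted_sum_mono:
  assumes "\<And>n. n0 \<le> n \<Longrightarrow> 0 \<le> a n" and "N \<le> N'"
  shows "shifted_sum a n0 N \<le> shifted_sum a n0 N'"
proof -
  have "shifted_sum a n0 N = (\<Sum>n. if enat n < N then ennreal (a (n0 + n)) else 0)"
    using assms(1) by (rule shifted_sum_eq_suminf)
  also have "\<dots> \<le> (\<Sum>n. if enat n < N' then ennreal (a (n0 + n)) else 0)"
    using assms(2) by (intro suminf_le summableI) auto
  also have "\<dots> = shifted_sum a n0 N'"
    using assms(1) by (rule shifted_sum_eq_suminf[symmetric])
  finally show ?thesis .
qed

text \<open>Serves twice: with the events themselves for (a), and with their tail unions for the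
  equality in (b). Pointwise the integrand is a series of nonnegative measurable functions, so the
  integral may be taken term by term.\<close>

lemma nn_integral_shifted_sum_decseq:
  assumes "\<And>n. n0 \<le> n \<Longrightarrow> 0 \<le> a n" and "decseq B" and [measurable]: "\<And>k. B k \<in> sets M"
  shows "(\<integral>\<^sup>+\<omega>. shifted_sum a n0 (\<Sum>k. indicator (B k) \<omega>) \<partial>M)
    = (\<Sum>k. ennreal (a (n0 + k)) * emeasure M (B k))"
proof -
  have "shifted_sum a n0 (\<Sum>k. indicator (B k) \<omega>)
      = (\<Sum>k. ennreal (a (n0 + k)) * indicator (B k) \<omega>)" for \<omega>
  proof -
    have "shifted_sum a n0 (\<Sum>k. indicator (B k) \<omega>)
        = (\<Sum>n. if enat n < (\<Sum>k. indicator (B k) \<omega>) then ennreal (a (n0 + n)) else 0)"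
      using assms(1) by (rule shifted_sum_eq_suminf)
    also have "\<dots> = (\<Sum>n. ennreal (a (n0 + n)) * indicator (B n) \<omega>)"
      unfolding less_suminf_indicator_decseq_iff[OF assms(2)] by (intro suminf_cong) simp
    finally show ?thesis .
  qed
  then show ?thesis
    by (simp add: nn_integral_suminf nn_integral_cmult_indicator)
qed

lemma decseq_Union_atLeast: "decseq (\<lambda>k. \<Union>m\<in>{n0 + k :: nat..}. A m)"
  by (fastforce simp: decseq_def)

lemma less_last_occurrence_iff:
  "enat n < last_occurrence A n0 \<omega> \<longleftrightarrow> \<omega> \<in> (\<Union>m\<in>{n0 + n..}. A m)"
proof -
  define I where "I = {i. n0 \<le> i \<and> \<omega> \<in> A i}"
  have rhs: "\<omega> \<in> (\<Union>m\<in>{n0 + n..}. A m) \<longleftrightarrow> (\<exists>i\<in>I. n0 + n \<le> i)"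
    unfolding I_def by (auto dest: add_leD1)
  consider "I = {}" | "I \<noteq> {}" "finite I" | "infinite I"
    by blast
  then show ?thesis
  proof cases
    case 1
    then have "last_occurrence A n0 \<omega> = 0"
      by (auto simp: last_occurrence_def I_def)
    then show ?thesis
      unfolding rhs using 1 by simp
  next
    case 2
    then have "max_index A n0 \<omega> = enat (Max I)"
      unfolding max_index_def Let_def I_def[symmetric] by simp
    then have "last_occurrence A n0 \<omega> = enat (Max I + 1 - n0)"
      using 2(1) by (auto simp: last_occurrence_def I_def one_enat_def)
    moreover have "n0 \<le> Max I"
      using Max_in[OF 2(2,1)] by (simp add: I_def)
    \<comment> \<open>The \<open>+ 1\<close> in the position turns the strict comparison into a weak
      one with \<open>Max I\<close>.\<close>
    ultimately have "enat n < last_occurrence A n0 \<omega> \<longleftrightarrow> n0 + n \<le> Max I"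
      by auto
    then show ?thesis
      unfolding rhs using Max_ge_iff[OF 2(2,1)] by blast
  next
    case 3
    then have "I \<noteq> {}"
      by auto
    with 3 have "max_index A n0 \<omega> = \<infinity>"
      unfolding max_index_def Let_def I_def[symmetric] by simp
    then have "last_occurrence A n0 \<omega> = \<infinity>"
      using \<open>I \<noteq> {}\<close> by (auto simp: last_occurrence_def I_def)
    moreover have "\<exists>i\<in>I. n0 + n \<le> i"
      using 3 by (meson infinite_nat_iff_unbounded_le)
    ultimately show ?thesis
      unfolding rhs by simp
  qed
qed

text \<open>Either side exceeds \<open>n\<close> exactly when some event of index at least
  \<open>n0 + n\<close> occurs; when infinitely many occur, both are infinite.\<close>

lemma last_occurrence_eq_suminf:
  "last_occurrence A n0 \<omega> = (\<Sum>k. indicator (\<Union>m\<in>{n0 + k..}. A m) \<omega>)"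
  by (rule enat_eqI_less)
    (simp only: less_last_occurrence_iff less_suminf_indicator_decseq_iff[OF decseq_Union_atLeast])

lemma overlap_count_le_last_occurrence: "overlap_count A n0 \<omega> \<le> last_occurrence A n0 \<omega>"
  unfolding overlap_count_def last_occurrence_eq_suminf
  by (intro suminf_le summableI) (auto simp: indicator_def)

theorem lemma1:
  fixes M :: "'a measure" and n0 :: nat and A :: "nat \<Rightarrow> 'a set" and a :: "nat \<Rightarrow> real"
  assumes "prob_space M"
    and events: "\<And>n. n0 \<le> n \<Longrightarrow> A n \<in> sets M"
    and summable: "summable (\<lambda>k. measure M (A (n0 + k)))"
    and pos: "\<And>n. n0 \<le> n \<Longrightarrow> 0 < a n"
    and mono: "mono_on {n0..} a"
  shows
    "((\<forall>n\<ge>n0. A (Suc n) \<subseteq> A n) \<longrightarrow>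
        (\<integral>\<^sup>+\<omega>. shifted_sum a n0 (overlap_count A n0 \<omega>) \<partial>M)
          = (\<Sum>k. ennreal (a (n0 + k)) * emeasure M (A (n0 + k))))
     \<and> (\<forall>\<omega>\<in>space M. last_occurrence A n0 \<omega> = (\<Sum>k. indicator (\<Union>m\<in>{n0 + k..}. A m) \<omega>))
     \<and> (\<integral>\<^sup>+\<omega>. shifted_sum a n0 (overlap_count A n0 \<omega>) \<partial>M)
         \<le> (\<integral>\<^sup>+\<omega>. shifted_sum a n0 (last_occurrence A n0 \<omega>) \<partial>M)
     \<and> (\<integral>\<^sup>+\<omega>. shifted_sum a n0 (last_occurrence A n0 \<omega>) \<partial>M)
         = (\<Sum>k. ennreal (a (n0 + k)) * emeasure M (\<Union>m\<in>{n0 + k..}. A m))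
     \<and> (\<Sum>k. ennreal (a (n0 + k)) * emeasure M (\<Union>m\<in>{n0 + k..}. A m))
         \<le> (\<Sum>k. ennreal (a (n0 + k)) * (\<Sum>j. emeasure M (A (n0 + k + j))))"
proof (intro conjI impI ballI)
  have nonneg: "0 \<le> a n" if "n0 \<le> n" for n
    using pos[OF that] by simp
  have union: "(\<Union>m\<in>{n0 + k..}. A m) \<in> sets M" for k
    using events by (intro sets.countable_UN') auto
  show "(\<integral>\<^sup>+\<omega>. shifted_sum a n0 (overlap_count A n0 \<omega>) \<partial>M)
      = (\<Sum>k. ennreal (a (n0 + k)) * emeasure M (A (n0 + k)))"
    if "\<forall>n\<ge>n0. A (Suc n) \<subseteq> A n"
    unfolding overlap_count_def using that nonneg events
    by (intro nn_integral_shifted_sum_decseq) (auto simp: decseq_Suc_iff)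
  show "last_occurrence A n0 \<omega> = (\<Sum>k. indicator (\<Union>m\<in>{n0 + k..}. A m) \<omega>)" for \<omega>
    by (rule last_occurrence_eq_suminf)
  show "(\<integral>\<^sup>+\<omega>. shifted_sum a n0 (overlap_count A n0 \<omega>) \<partial>M)
      \<le> (\<integral>\<^sup>+\<omega>. shifted_sum a n0 (last_occurrence A n0 \<omega>) \<partial>M)"
    by (intro nn_integral_mono shifted_sum_mono nonneg overlap_count_le_last_occurrence)
  show "(\<integral>\<^sup>+\<omega>. shifted_sum a n0 (last_occurrence A n0 \<omega>) \<partial>M)
      = (\<Sum>k. ennreal (a (n0 + k)) * emeasure M (\<Union>m\<in>{n0 + k..}. A m))"
    \<comment> \<open>Rewritten this way, the last occurrence index counts nested events, so the
      computation behind (a) applies to the tail unions.\<close>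
    unfolding last_occurrence_eq_suminf
    by (rule nn_integral_shifted_sum_decseq[OF nonneg decseq_Union_atLeast union])
  have "emeasure M (\<Union>m\<in>{n0 + k..}. A m) \<le> (\<Sum>j. emeasure M (A (n0 + k + j)))" for k
  proof -
    \<comment> \<open>Substituting \<open>m = n0 + k + j\<close> presents the tail as a sequence
      indexed from 0, the form that countable subadditivity takes.\<close>
    have "(\<Union>m\<in>{n0 + k..}. A m) = (\<Union>j. A (n0 + k + j))"
      by (auto simp: le_iff_add) (metis atLeast_iff le_add1 add.assoc)
    then show ?thesis
      using events by (auto intro!: emeasure_subadditive_countably)
  qed
  then show "(\<Sum>k. ennreal (a (n0 + k)) * emeasure M (\<Union>m\<in>{n0 + k..}. A m))
      \<le> (\<Sum>k. ennreal (a (n0 + k)) * (\<Sum>j. emeasure M (A (n0 + k + j))))"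
    by (intro suminf_le summableI mult_left_mono) auto
qed

end
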